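(* In the two-stage distributionally robust setting described in the context, consider the semidefinite program $$\begin{array}{rl}\inf&\bm c^\top\bm x+\alpha+\bm\beta^\top\bm\mu+\mathrm{tr}(\bm\Gamma\bm\Sigma)\\ \text{s.t.}&\bm x\in\mathcal{X},\ \bm\Gamma\in\mathbb{S}^K_+,\ \bm\beta\in\mathbb{R}^K,\ \alpha\in\mathbb{R},\\ &\bm Y_j\in\mathbb{R}^{N_2\times K},\ \bm y_j\in\mathbb{R}^{N_2},\ \bm\gamma_j\in\mathbb{R}_+^{L_j},\ \delta_j\in\mathbb{R}_+\quad\forall j\in[J],\\ &\lambda_{j\ell}\in\mathbb{R}_+,\ \bm\rho_{j\ell}\in\mathbb{R}_+^{L_j}\quad\forall j\in[J],\ \forall\ell\in[L],\\ &\begin{bmatrix}\bm\Gamma&\frac12\bm\beta\\ \frac12\bm\beta^\top&\alpha\end{bmatrix}-\begin{bmatrix}\frac12(\bm D^\top\bm Y_j+\bm Y_j^\top\bm D)&\frac12(\bm D^\top\bm y_j+\bm Y_j^\top\bm d)\\ \frac12(\bm D^\top\bm y_j+\bm Y_j^\top\bm d)^\top&\bm d^\top\bm y_j\end{bmatrix}+\bm P_j(\bm\gamma_j)+\delta_j\bm J_j\succeq\bm 0\quad\forall j\in[J],\\ &\begin{bmatrix}\frac12(\bm W_\ell^\top\bm Y_j+\bm Y_j^\top\bm W_\ell)&\frac12(\bm W_\ell^\top\bm y_j+\bm Y_j^\top\bm w_\ell)\\ \frac12(\bm W_\ell^\top\bm y_j+\bm Y_j^\top\bm w_\ell)^\top&\bm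 w_\ell^\top\bm y_j\end{bmatrix}-\bm M_\ell(\bm x)+\bm P_j(\bm\rho_{j\ell})+\lambda_{j\ell}\bm J_j\succeq\bm 0\quad\forall j\in[J],\ \forall\ell\in[L],\end{array}$$ where $$\bm M_\ell(\bm x)=\begin{bmatrix}\bm 0&\frac12\bm T_\ell(\bm x)\\ \frac12\bm T_\ell(\bm x)^\top&h_\ell(\bm x)\end{bmatrix},\quad\bm P_j(\bm\rho)=\begin{bmatrix}\bm 0&\frac12\bm S_j^\top\bm\rho\\ \frac12\bm\rho^\top\bm S_j&-\bm t_j^\top\bm\rho\end{bmatrix},\quad\bm J_j=\begin{bmatrix}\bm A_j^2&\bm A_j^\top\bm b_j\\ \bm b_j^\top\bm A_j&\bm b_j^\top\bm b_j-1\end{bmatrix}.$$ With $\bm x$, $\bm Y_j$, $\bm y_j$ taken from a feasible solution of this program, let $\bm y(\bm\xi)=\bm Y_j\bm\xi+\bm y_j$ if $\bm\xi\in\Xi_j$. Then $(\bm x,\bm y(\cdot))$ provides a feasible solution to the problem $$\text{(R)}\quad\begin{array}{rl}\inf\limits_{\bm x,\bm y(\cdot)}&\bm c^\top\bm x+\sup_{\mathbb{Q}\in\mathcal{Q}}\mathbb{E}_{\mathbb{Q}}[(\bm D\tilde{\bm\xi}+\bm d)^\top\bm y(\tilde{\bm\xi})]\\ \text{s.t.}&\bm x\in\mathcal{X},\\ &\bm T_\ell(\bm x)^\top\bm\xi+h_\ell(\bm x)\le(\bm W_\ell\bm\xi+\bm w_\ell)^\top\bm y(\bm\xi)\quad\forall\bm\xi\in\Xi,\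 \forall\ell\in[L].\end{array}$$ Furthermore, the optimal value of the semidefinite program provides an upper bound to the optimal value of (R).
   Context: $[n]=\{1,\dots,n\}$; $\mathbb{S}^K_+$ ($\mathbb{S}^K_{++}$) is the set of symmetric positive semidefinite (definite) $K\times K$ matrices; $\mathbb{R}_+^n$ is the nonnegative orthant; $\|\cdot\|$ is the Euclidean norm; $\bm P\succeq\bm Q$ means $\bm P-\bm Q$ is symmetric positive semidefinite; vector inequalities are componentwise. Setting. $\bm x\in\mathbb{R}^{N_1}$ is the first-stage decision, $\mathcal{X}\subseteq\mathbb{R}^{N_1}$ is a set defined by tractable convex constraints on $\bm x$, and the second-stage decision $\bm y(\cdot)$ is a function of the uncertain parameters $\bm\xi\in\mathbb{R}^K$ with values in $\mathbb{R}^{N_2}$. The data are $\bm c\in\mathbb{R}^{N_1}$, $\bm D\in\mathbb{R}^{N_2\times K}$, $\bm d\in\mathbb{R}^{N_2}$, and for $\ell\in[L]$: $\bm W_\ell\in\mathbb{R}^{N_2\times K}$, $\bm w_\ell\in\mathbb{R}^{N_2}$, and affine functions $\bm T_\ell:\mathcal{X}\to\mathbb{R}^K$, $h_\ell:\mathcal{X}\to\mathbb{R}$. The support set $\Xi=\{\bm\xi\in\mathbb{R}^K:\bm S\bm\xi\le\bm t\}$ is bounded. The ambiguity set is $\mathcal{Q}=\{\mathbb{Q}\in\mathcal{Q}_0(\Xi):\mathbb{E}_{\mathbb{Q}}[\tilde{\bm\xi}]=\bm\mu,\ \mathbb{E}_{\mathbb{Q}}[\tilde{\bm\xi}\tilde{\bm\xi}^\top]\preceq\bm\Sigma\}$,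 where $\mathcal{Q}_0(\Xi)$ is the set of all probability measures supported on $\Xi$, $\bm\mu\in\mathbb{R}^K$ and $\bm\Sigma$ is a symmetric $K\times K$ matrix. Partition. Given constructor points $\bm\xi_1,\dots,\bm\xi_J\in\Xi$, the set $\Xi$ is partitioned into the Voronoi regions $\Xi_j=\{\bm\xi\in\mathbb{R}^K:\bm S\bm\xi\le\bm t,\ \|\bm\xi-\bm\xi_j\|\le\|\bm\xi-\bm\xi_i\|\ \forall i\in[J],\ i\ne j\}$, $j\in[J]$. Each is written as $\Xi_j=\{\bm\xi\in\mathbb{R}^K:\bm S_j\bm\xi\le\bm t_j\}$ with $\bm S_j\in\mathbb{R}^{L_j\times K}$, $\bm t_j\in\mathbb{R}^{L_j}$, obtained by combining the linear inequalities $\bm S\bm\xi\le\bm t$ and $2(\bm\xi_i-\bm\xi_j)^\top\bm\xi\le\bm\xi_i^\top\bm\xi_i-\bm\xi_j^\top\bm\xi_j$, $i\ne j$. For each $j\in[J]$, $\bm A_j\in\mathbb{S}^K_{++}$ and $\bm b_j\in\mathbb{R}^K$ are such that the ellipsoid $\{\bm\xi\in\mathbb{R}^K:\|\bm A_j\bm\xi+\bm b_j\|^2\le1\}$ contains $\Xi_j$. *)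

theory Defs
  imports "HOL-Probability.Probability"
begin

section \<open>Matrices and affine maps\<close>

definition symmetric_matrix :: "real^'n^'n \<Rightarrow> bool" where
  "symmetric_matrix A \<longleftrightarrow> transpose A = A"

definition psd :: "real^'n^'n \<Rightarrow> bool" where
  "psd A \<longleftrightarrow> symmetric_matrix A \<and> (\<forall>v. 0 \<le> v \<bullet> (A *v v))"

definition pos_def :: "real^'n^'n \<Rightarrow> bool" where
  "pos_def A \<longleftrightarrow> symmetric_matrix A \<and> (\<forall>v. v \<noteq> 0 \<longrightarrow> 0 < v \<bullet> (A *v v))"

text \<open>The block matrix with first block row \<open>[Q, q]\<close> and second block row \<open>[q\<^sup>T, r]\<close>.  The
  one-element summand of the index type carries the additional coordinate.\<close>

definition bordered :: "real^'k^'k \<Rightarrow> real^'k \<Rightarrow> real \<Rightarrow> real^('k + 1)^('k + 1)" where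
  "bordered Q q r = (\<chi> i j. case i of
      Inl a \<Rightarrow> (case j of Inl b \<Rightarrow> Q $ a $ b | Inr _ \<Rightarrow> q $ a)
    | Inr _ \<Rightarrow> (case j of Inl b \<Rightarrow> q $ b | Inr _ \<Rightarrow> r))"

definition affine_map_on :: "'a::real_vector set \<Rightarrow> ('a \<Rightarrow> 'b::real_vector) \<Rightarrow> bool" where
  "affine_map_on X f \<longleftrightarrow> (\<exists>g b. linear g \<and> (\<forall>x\<in>X. f x = g x + b))"


section \<open>The two-stage distributionally robust problem\<close>

record ('n1::finite, 'n2::finite, 'k::finite, 'm::finite, 'l::finite) two_stage =
  first_stage :: "(real^'n1) set"
  cost_c :: "real^'n1"
  cost_D :: "real^'k^'n2"
  cost_d :: "real^'n2"
  rec_W :: "'l \<Rightarrow> real^'k^'n2"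
  rec_w :: "'l \<Rightarrow> real^'n2"
  rhs_T :: "'l \<Rightarrow> real^'n1 \<Rightarrow> real^'k"
  rhs_h :: "'l \<Rightarrow> real^'n1 \<Rightarrow> real"
  supp_S :: "real^'k^'m"
  supp_t :: "real^'m"
  mean_mu :: "real^'k"
  mom_Sigma :: "real^'k^'k"

definition support ::
  "('n1::finite, 'n2::finite, 'k::finite, 'm::finite, 'l::finite) two_stage \<Rightarrow> (real^'k) set" where
  "support P = {\<xi>. supp_S P *v \<xi> \<le> supp_t P}"

text \<open>The support is bounded, so the Bochner integrals of \<open>\<xi>\<close> and \<open>\<xi>\<xi>\<^sup>T\<close> below always exist.\<close>

definition ambiguity ::
  "('n1::finite, 'n2::finite, 'k::finite, 'm::finite, 'l::finite) two_stage \<Rightarrow> (real^'k) measure set"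
  where
  "ambiguity P = {Q. prob_space Q \<and> sets Q = sets borel \<and> measure Q (support P) = 1 \<and>
     (\<integral>\<xi>. \<xi> \<partial>Q) = mean_mu P \<and>
     psd (mom_Sigma P - (\<integral>\<xi>. (\<chi> a b. \<xi> $ a * \<xi> $ b) \<partial>Q))}"

text \<open>The expectation of a measurable function as an extended real number.  If the positive and the
  negative part both have infinite expectation, the value is \<open>\<infinity>\<close> (the usual convention in
  minimization), because \<open>\<infinity> - \<infinity> = \<infinity>\<close> in \<^typ>\<open>ereal\<close>.\<close>

definition expect :: "'a measure \<Rightarrow> ('a \<Rightarrow> real) \<Rightarrow> ereal" where
  "expect Q f = enn2ereal (\<integral>\<^sup>+ z. ennreal (f z) \<partial>Q) - enn2ereal (\<integral>\<^sup>+ z. ennreal (- f z) \<partial>Q)"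

definition R_feasible ::
  "('n1::finite, 'n2::finite, 'k::finite, 'm::finite, 'l::finite) two_stage \<Rightarrow>
   real^'n1 \<Rightarrow> (real^'k \<Rightarrow> real^'n2) \<Rightarrow> bool" where
  "R_feasible P x y \<longleftrightarrow> x \<in> first_stage P \<and>
     (\<forall>\<xi>\<in>support P. \<forall>l. rhs_T P l x \<bullet> \<xi> + rhs_h P l x \<le> (rec_W P l *v \<xi> + rec_w P l) \<bullet> y \<xi>)"

definition R_objective ::
  "('n1::finite, 'n2::finite, 'k::finite, 'm::finite, 'l::finite) two_stage \<Rightarrow>
   real^'n1 \<Rightarrow> (real^'k \<Rightarrow> real^'n2) \<Rightarrow> ereal" where
  "R_objective P x y = ereal (cost_c P \<bullet> x) +
     (SUP Q\<in>ambiguity P. expect Q (\<lambda>\<xi>. (cost_D P *v \<xi> + cost_d P) \<bullet> y \<xi>))"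

text \<open>The infimum is over Borel measurable recourse functions, for which the expectations are
  defined.\<close>

definition R_value ::
  "('n1::finite, 'n2::finite, 'k::finite, 'm::finite, 'l::finite) two_stage \<Rightarrow> ereal" where
  "R_value P = Inf {R_objective P x y | x y. y \<in> borel_measurable borel \<and> R_feasible P x y}"


section \<open>The Voronoi partition\<close>

record ('k::finite, 'j::finite) partition =
  pts :: "'j \<Rightarrow> real^'k"
  ell_A :: "'j \<Rightarrow> real^'k^'k"
  ell_b :: "'j \<Rightarrow> real^'k"

definition region ::
  "('n1::finite, 'n2::finite, 'k::finite, 'm::finite, 'l::finite) two_stage \<Rightarrow>
   ('k, 'j::finite) partition \<Rightarrow> 'j \<Rightarrow> (real^'k) set" where
  "region P V j = {\<xi>. supp_S P *v \<xi> \<le> supp_t P \<and>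
     (\<forall>i. i \<noteq> j \<longrightarrow> norm (\<xi> - pts V j) \<le> norm (\<xi> - pts V i))}"

text \<open>The rows of \<open>S\<^sub>j\<close> and \<open>t\<^sub>j\<close> are indexed by the set \<open>region_rows j\<close> (of cardinality \<open>L\<^sub>j\<close>):
  \<open>Inl r\<close> is row \<open>r\<close> of the system that defines the support, and \<open>Inr i\<close> with \<open>i \<noteq> j\<close> is the
  bisector inequality for the points \<open>j\<close> and \<open>i\<close>.  A vector in \<open>\<real>\<close> to the power \<open>L\<^sub>j\<close> is a function
  of which only the values on \<open>region_rows j\<close> are used.\<close>

definition region_rows :: "'j \<Rightarrow> ('m::finite + 'j::finite) set" where
  "region_rows j = UNIV <+> (- {j})"

definition region_S ::
  "('n1::finite, 'n2::finite, 'k::finite, 'm::finite, 'l::finite) two_stage \<Rightarrow>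
   ('k, 'j::finite) partition \<Rightarrow> 'j \<Rightarrow> 'm + 'j \<Rightarrow> real^'k" where
  "region_S P V j q = (case q of Inl r \<Rightarrow> supp_S P $ r | Inr i \<Rightarrow> 2 *\<^sub>R (pts V i - pts V j))"

definition region_t ::
  "('n1::finite, 'n2::finite, 'k::finite, 'm::finite, 'l::finite) two_stage \<Rightarrow>
   ('k, 'j::finite) partition \<Rightarrow> 'j \<Rightarrow> 'm + 'j \<Rightarrow> real" where
  "region_t P V j q =
     (case q of Inl r \<Rightarrow> supp_t P $ r | Inr i \<Rightarrow> pts V i \<bullet> pts V i - pts V j \<bullet> pts V j)"

lemma region_polyhedron:
  fixes P :: "('n1::finite, 'n2::finite, 'k::finite, 'm::finite, 'l::finite) two_stage"
    and V :: "('k, 'j::finite) partition"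
  shows "region P V j = {\<xi>. \<forall>q\<in>region_rows j. region_S P V j q \<bullet> \<xi> \<le> region_t P V j q}"
proof -
  have 1: "norm (\<xi> - a) \<le> norm (\<xi> - b) \<longleftrightarrow> (2 *\<^sub>R (b - a)) \<bullet> \<xi> \<le> b \<bullet> b - a \<bullet> a"
    for \<xi> a b :: "real^'k"
    by (simp add: norm_le inner_diff_left inner_diff_right inner_commute algebra_simps)
  have 2: "(\<forall>q\<in>region_rows j. Z q) \<longleftrightarrow> (\<forall>r. Z (Inl r)) \<and> (\<forall>i. i \<noteq> j \<longrightarrow> Z (Inr i))"
    for Z :: "'m + 'j \<Rightarrow> bool"
    by (auto simp: region_rows_def)
  have 3: "supp_S P *v \<xi> \<le> supp_t P \<longleftrightarrow> (\<forall>r. supp_S P $ r \<bullet> \<xi> \<le> supp_t P $ r)" for \<xi>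
    by (simp add: less_eq_vec_def matrix_vector_mul_component)
  show ?thesis
    unfolding region_def region_S_def region_t_def 1 2 3 by simp
qed

definition mat_P ::
  "('n1::finite, 'n2::finite, 'k::finite, 'm::finite, 'l::finite) two_stage \<Rightarrow>
   ('k, 'j::finite) partition \<Rightarrow> 'j \<Rightarrow> ('m + 'j \<Rightarrow> real) \<Rightarrow> real^('k + 1)^('k + 1)" where
  "mat_P P V j \<rho> = bordered 0
     ((1/2) *\<^sub>R (\<Sum>q\<in>region_rows j. \<rho> q *\<^sub>R region_S P V j q))
     (- (\<Sum>q\<in>region_rows j. region_t P V j q * \<rho> q))"

definition mat_J ::
  "('k::finite, 'j::finite) partition \<Rightarrow> 'j \<Rightarrow> real^('k + 1)^('k + 1)" where
  "mat_J V j = bordered (ell_A V j ** ell_A V j) (transpose (ell_A V j) *v ell_b V j)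
     (ell_b V j \<bullet> ell_b V j - 1)"

definition mat_M ::
  "('n1::finite, 'n2::finite, 'k::finite, 'm::finite, 'l::finite) two_stage \<Rightarrow>
   'l \<Rightarrow> real^'n1 \<Rightarrow> real^('k + 1)^('k + 1)" where
  "mat_M P l x = bordered 0 ((1/2) *\<^sub>R rhs_T P l x) (rhs_h P l x)"

text \<open>The matrix of the quadratic form that represents \<open>(B \<xi> + b)\<^sup>T (Y \<xi> + y)\<close>.\<close>

definition mat_bil ::
  "real^'k^'n2 \<Rightarrow> real^'n2 \<Rightarrow> real^'k^'n2 \<Rightarrow> real^'n2 \<Rightarrow> real^('k + 1)^('k + 1)" where
  "mat_bil B b Y y = bordered
     ((1/2) *\<^sub>R (transpose B ** Y + transpose Y ** B))
     ((1/2) *\<^sub>R (transpose B *v y + transpose Y *v b))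
     (b \<bullet> y)"


section \<open>The semidefinite program\<close>

record ('n1::finite, 'n2::finite, 'k::finite, 'm::finite, 'l::finite, 'j::finite) sdp_vars =
  var_x :: "real^'n1"
  var_Gamma :: "real^'k^'k"
  var_beta :: "real^'k"
  var_alpha :: real
  var_Y :: "'j \<Rightarrow> real^'k^'n2"
  var_y :: "'j \<Rightarrow> real^'n2"
  var_gamma :: "'j \<Rightarrow> 'm + 'j \<Rightarrow> real"
  var_delta :: "'j \<Rightarrow> real"
  var_lambda :: "'j \<Rightarrow> 'l \<Rightarrow> real"
  var_rho :: "'j \<Rightarrow> 'l \<Rightarrow> 'm + 'j \<Rightarrow> real"

definition sdp_feasible ::
  "('n1::finite, 'n2::finite, 'k::finite, 'm::finite, 'l::finite) two_stage \<Rightarrow>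
   ('k, 'j::finite) partition \<Rightarrow> ('n1, 'n2, 'k, 'm, 'l, 'j) sdp_vars \<Rightarrow> bool" where
  "sdp_feasible P V s \<longleftrightarrow>
     var_x s \<in> first_stage P \<and> psd (var_Gamma s) \<and>
     (\<forall>j. (\<forall>q\<in>region_rows j. 0 \<le> var_gamma s j q) \<and> 0 \<le> var_delta s j) \<and>
     (\<forall>j l. 0 \<le> var_lambda s j l \<and> (\<forall>q\<in>region_rows j. 0 \<le> var_rho s j l q)) \<and>
     (\<forall>j. psd (bordered (var_Gamma s) ((1/2) *\<^sub>R var_beta s) (var_alpha s)
             - mat_bil (cost_D P) (cost_d P) (var_Y s j) (var_y s j)
             + mat_P P V j (var_gamma s j) + var_delta s j *\<^sub>R mat_J V j)) \<and>
     (\<forall>j l. psd (mat_bil (rec_W P l) (rec_w P l) (var_Y s j) (var_y s j)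
             - mat_M P l (var_x s)
             + mat_P P V j (var_rho s j l) + var_lambda s j l *\<^sub>R mat_J V j))"

definition sdp_objective ::
  "('n1::finite, 'n2::finite, 'k::finite, 'm::finite, 'l::finite) two_stage \<Rightarrow>
   ('n1, 'n2, 'k, 'm, 'l, 'j::finite) sdp_vars \<Rightarrow> real" where
  "sdp_objective P s = cost_c P \<bullet> var_x s + var_alpha s + var_beta s \<bullet> mean_mu P
     + trace (var_Gamma s ** mom_Sigma P)"

definition sdp_value ::
  "('n1::finite, 'n2::finite, 'k::finite, 'm::finite, 'l::finite) two_stage \<Rightarrow>
   ('k, 'j::finite) partition \<Rightarrow> ereal" where
  "sdp_value P V = Inf {ereal (sdp_objective P s) | s :: ('n1, 'n2, 'k, 'm, 'l, 'j) sdp_vars.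
     sdp_feasible P V s}"

text \<open>Neighbouring regions share boundary points, where any of the competing pieces may be chosen;
  outside the support the function is arbitrary.\<close>

definition piecewise_rule ::
  "('n1::finite, 'n2::finite, 'k::finite, 'm::finite, 'l::finite) two_stage \<Rightarrow>
   ('k, 'j::finite) partition \<Rightarrow> ('j \<Rightarrow> real^'k^'n2) \<Rightarrow> ('j \<Rightarrow> real^'n2) \<Rightarrow>
   (real^'k \<Rightarrow> real^'n2) \<Rightarrow> bool" where
  "piecewise_rule P V Y y\<^sub>0 y \<longleftrightarrow>
     (\<forall>\<xi>\<in>support P. \<exists>j. \<xi> \<in> region P V j \<and> y \<xi> = Y j *v \<xi> + y\<^sub>0 j)"

end

theory Submission
  imports Defs
begin

text \<open>Evaluated at \<open>(\<xi>, 1)\<close>, the quadratic forms of \<open>P\<^sub>j(\<rho>)\<close> with \<open>\<rho> \<ge> 0\<close> and of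
  \<open>J\<^sub>j\<close> are nonpositive for \<open>\<xi> \<in> \<Xi>\<^sub>j\<close>.  So the second family of semidefinite constraints gives
  robust feasibility on every region, and the first one gives the majorant
  \<open>\<xi>\<^sup>T \<Gamma> \<xi> + \<beta>\<^sup>T \<xi> + \<alpha>\<close> of the recourse cost on the support.  Its expectation depends only on the
  first two moments; replacing the second moment by \<open>\<Sigma>\<close> does not decrease it, because the trace of
  a product of two positive semidefinite matrices is nonnegative.\<close>

section \<open>Positive semidefinite matrices\<close>

lemma quadratic_form_add:
  fixes A :: "real^'n^'n"
  shows "v \<bullet> ((A + B) *v v) = v \<bullet> (A *v v) + v \<bullet> (B *v v)"
  by (simp add: matrix_vector_mult_add_rdistrib inner_add_right)

lemma quadratic_form_diff:
  fixes A :: "real^'n^'n"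
  shows "v \<bullet> ((A - B) *v v) = v \<bullet> (A *v v) - v \<bullet> (B *v v)"
  by (simp add: matrix_vector_mult_diff_rdistrib inner_diff_right)

lemma quadratic_form_scaleR:
  fixes A :: "real^'n^'n"
  shows "v \<bullet> ((c *\<^sub>R A) *v v) = c * (v \<bullet> (A *v v))"
  by (simp add: scaleR_matrix_vector_assoc[symmetric])

text \<open>The rank-one matrix \<open>v v\<^sup>T\<close>. It serves twice: as the pivot term of
  the decomposition below, and as the integrand of the second moment in
  \<open>ambiguity\<close>.\<close>

definition outer :: "real^'n \<Rightarrow> real^'n^'n" where
  "outer v = (\<chi> a b. v $ a * v $ b)"

lemma outer_vector_mult: "outer u *v v = (u \<bullet> v) *\<^sub>R u"
  by (simp add: vec_eq_iff matrix_vector_mult_def outer_def inner_vec_def sum_distrib_left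
      sum_distrib_right algebra_simps)

lemma trace_mult_outer: "trace (A ** outer v) = v \<bullet> (A *v v)"
  by (simp add: trace_def matrix_matrix_mult_def outer_def inner_vec_def matrix_vector_mult_def
      sum_distrib_left algebra_simps)

lemma symmetric_matrix_entry: "symmetric_matrix A \<Longrightarrow> A $ i $ j = A $ j $ i"
  unfolding symmetric_matrix_def by (metis transpose_def vec_lambda_beta)

text \<open>By symmetry the image of the \<open>i\<close>-th unit vector is the row
  \<open>A $ i\<close>, so the two cross terms coincide. The result is a polynomial in
  \<open>t\<close>; both applications below pick a suitable \<open>t\<close>.\<close>

lemma quadratic_form_diff_axis:
  fixes A :: "real^'n^'n"
  assumes "symmetric_matrix A"
  shows "(v - t *\<^sub>R axis i 1) \<bullet> (A *v (v - t *\<^sub>R axis i 1)) =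
    v \<bullet> (A *v v) - 2 * t * (A $ i \<bullet> v) + t\<^sup>2 * A $ i $ i"
proof -
  have *: "A *v axis i 1 = A $ i"
    using symmetric_matrix_entry[OF assms]
    by (simp add: vec_eq_iff matrix_vector_mult_basis column_def)
  have "axis i 1 \<bullet> (A *v v) = A $ i \<bullet> v"
    by (simp add: inner_axis' matrix_vector_mul_component)
  moreover have "axis i 1 \<bullet> A $ i = A $ i $ i"
    by (simp add: inner_axis')
  ultimately show ?thesis
    by (simp add: matrix_vector_mult_diff_distrib matrix_vector_mult_scaleR * inner_diff_left
        inner_diff_right algebra_simps power2_eq_square inner_commute)
qed

lemma psd_diag_nonneg: "psd A \<Longrightarrow> 0 \<le> A $ i $ i"
  unfolding psd_def
  by (drule conjunct2, drule spec[of _ "axis i 1"])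
     (simp add: inner_axis' matrix_vector_mult_basis column_def)

text \<open>If the diagonal entry vanishes, the polynomial of
  \<open>quadratic_form_diff_axis\<close> at \<open>v = A $ i\<close> is affine in \<open>t\<close>
  with slope \<open>- 2 * (v \<bullet> v)\<close>. A nonzero row would make it negative for large
  \<open>t\<close>.\<close>

lemma psd_diag_zero:
  assumes "psd A" "A $ i $ i = 0"
  shows "A $ i = 0"
proof (rule ccontr)
  assume "A $ i \<noteq> 0"
  define v where "v = A $ i"
  have pos: "v \<bullet> v > 0"
    using \<open>A $ i \<noteq> 0\<close> by (simp add: v_def)
  \<comment> \<open>Chosen so that the affine function of \<open>t\<close> takes the value
    -1.\<close>
  define t where "t = (v \<bullet> (A *v v) + 1) / (2 * (v \<bullet> v))"
  have sym: "symmetric_matrix A"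
    using assms(1) by (simp add: psd_def)
  have "0 \<le> v \<bullet> (A *v v) - 2 * t * (v \<bullet> v)"
    using quadratic_form_diff_axis[OF sym, of v t i] assms
    unfolding psd_def v_def[symmetric] by (metis add.right_neutral mult_zero_right)
  also have "\<dots> = -1"
    using pos by (simp add: t_def field_simps)
  finally show False by simp
qed

text \<open>One step of the Cholesky decomposition.\<close>

lemma psd_diff_outer:
  assumes "psd A" "A $ i $ i \<noteq> 0"
  shows "psd (A - (1 / A $ i $ i) *\<^sub>R outer (A $ i))"
  unfolding psd_def
proof (intro conjI allI)
  have sym: "symmetric_matrix A"
    using assms(1) by (simp add: psd_def)
  then show "symmetric_matrix (A - (1 / A $ i $ i) *\<^sub>R outer (A $ i))"
    using symmetric_matrix_entry[OF sym]
    by (simp add: symmetric_matrix_def transpose_def outer_def vec_eq_iff)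
  fix v
  \<comment> \<open>The minimizer of the quadratic polynomial in \<open>t\<close>; its minimum is
    the quadratic form of the reduced matrix.\<close>
  define t where "t = (A $ i \<bullet> v) / A $ i $ i"
  have "0 \<le> v \<bullet> (A *v v) - 2 * t * (A $ i \<bullet> v) + t\<^sup>2 * A $ i $ i"
    using assms(1) quadratic_form_diff_axis[OF sym, of v t i] unfolding psd_def by metis
  also have "\<dots> = v \<bullet> ((A - (1 / A $ i $ i) *\<^sub>R outer (A $ i)) *v v)"
    using assms(2)
    unfolding quadratic_form_diff quadratic_form_scaleR outer_vector_mult t_def
    by (simp add: field_simps power2_eq_square inner_commute)
  finally show "0 \<le> v \<bullet> ((A - (1 / A $ i $ i) *\<^sub>R outer (A $ i)) *v v)" .
qed

lemma linear_trace_mult: "linear (\<lambda>A. trace (B ** A))" for B :: "real^'n^'n"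
  by (rule linearI) (simp_all add: matrix_add_ldistrib trace_add trace_def matrix_matrix_mult_def
      sum_distrib_left algebra_simps sum.distrib)

text \<open>Pivoting writes \<open>A\<close> as a sum of nonnegative multiples of matrices
  \<open>outer u\<close>, and each contributes a multiple of \<open>u \<bullet> (B *v u)\<close>.
  The induction is on the number of nonzero diagonal entries, so no eigenvectors or matrix square
  roots enter.\<close>

lemma trace_psd_mult_nonneg:
  assumes "psd A" "psd B"
  shows "0 \<le> trace (A ** B)"
  using assms(1)
proof (induction "card {i. A $ i $ i \<noteq> 0}" arbitrary: A rule: less_induct)
  case less
  show ?case
  proof (cases "\<exists>i. A $ i $ i \<noteq> 0")
    case False
    then have "A = 0"
      using psd_diag_zero[OF less.prems] by (simp add: vec_eq_iff)
    then show ?thesis by (simp add: trace_def matrix_matrix_mult_def)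
  next
    case True
    then obtain i where i: "A $ i $ i \<noteq> 0" by blast
    define A' where "A' = A - (1 / A $ i $ i) *\<^sub>R outer (A $ i)"
    have psd': "psd A'"
      unfolding A'_def by (rule psd_diff_outer[OF less.prems i])
    \<comment> \<open>A zero diagonal entry is not refilled: row \<open>j\<close> of
      \<open>A\<close> vanishes, hence by symmetry so does \<open>A $ i $ j\<close>, the entry that
      \<open>outer (A $ i)\<close> would square.\<close>
    have "A' $ j $ j = 0" if "A $ j $ j = 0" for j
      using that psd_diag_zero[OF less.prems that] symmetric_matrix_entry[of A i j] less.prems
      by (simp add: A'_def outer_def psd_def)
    moreover have "A' $ i $ i = 0"
      using i by (simp add: A'_def outer_def)
    ultimately have "{j. A' $ j $ j \<noteq> 0} \<subset> {j. A $ j $ j \<noteq> 0}"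
      using i by blast
    then have "0 \<le> trace (A' ** B)"
      by (intro less.hyps psd' psubset_card_mono) auto
    moreover have "trace (A ** B) = trace (A' ** B) + (1 / A $ i $ i) * (A $ i \<bullet> (B *v A $ i))"
    proof -
      \<comment> \<open>Cyclicity moves \<open>A\<close> to the right factor, where
        \<open>linear_trace_mult\<close> applies.\<close>
      have "trace (A ** B) = trace (B ** (A' + (1 / A $ i $ i) *\<^sub>R outer (A $ i)))"
        unfolding A'_def by (subst trace_mul_sym) simp
      also have "\<dots> = trace (B ** A') + (1 / A $ i $ i) * trace (B ** outer (A $ i))"
        using linear_add[OF linear_trace_mult] linear_scale[OF linear_trace_mult]
        by (metis real_scaleR_def)
      finally show ?thesis
        by (simp add: trace_mult_outer trace_mul_sym[of B A'])
    qed
    moreover have "0 \<le> (1 / A $ i $ i) * (A $ i \<bullet> (B *v A $ i))"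
      using psd_diag_nonneg[OF less.prems, of i] assms(2) by (simp add: psd_def)
    ultimately show ?thesis by linarith
  qed
qed


section \<open>Quadratic forms of the block matrices\<close>

text \<open>The point \<open>(\<xi>, 1)\<close>: evaluated there, the quadratic form of a bordered
  matrix is an inhomogeneous quadratic function of \<open>\<xi>\<close>.\<close>

definition homogenize :: "real^'k \<Rightarrow> real^('k + 1)" where
  "homogenize \<xi> = (\<chi> i. case i of Inl a \<Rightarrow> \<xi> $ a | Inr _ \<Rightarrow> 1)"

lemma sum_UNIV_Plus_1:
  fixes f :: "'k::finite + 1 \<Rightarrow> real"
  shows "sum f UNIV = (\<Sum>a\<in>UNIV. f (Inl a)) + f (Inr 1)"
  by (simp add: UNIV_Plus_UNIV[symmetric] sum.Plus UNIV_1 del: UNIV_Plus_UNIV)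

lemma bordered_quadratic_form:
  "homogenize \<xi> \<bullet> (bordered Q q r *v homogenize \<xi>) = \<xi> \<bullet> (Q *v \<xi>) + 2 * (q \<bullet> \<xi>) + r"
  by (simp add: inner_vec_def matrix_vector_mult_def homogenize_def bordered_def sum_UNIV_Plus_1
      algebra_simps sum.distrib sum_distrib_left)

text \<open>Symmetrization leaves the form unchanged: both transposed products give the same scalar,
  so the factors 1/2 cancel.\<close>

lemma mat_bil_quadratic_form:
  "homogenize \<xi> \<bullet> (mat_bil B b Y y *v homogenize \<xi>) = (B *v \<xi> + b) \<bullet> (Y *v \<xi> + y)"
proof -
  have tr: "u \<bullet> (transpose C *v w) = (C *v u) \<bullet> w" for u w and C :: "real^'k^'n"
    by (metis dot_lmul_matrix inner_commute transpose_matrix_vector)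
  have tr': "(transpose C *v w) \<bullet> u = (C *v u) \<bullet> w" for u w and C :: "real^'k^'n"
    using tr by (simp only: inner_commute)
  show ?thesis
    unfolding mat_bil_def bordered_quadratic_form quadratic_form_scaleR quadratic_form_add
    by (simp add: matrix_vector_mul_assoc[symmetric] tr tr' inner_add_left inner_add_right
        inner_commute del: transpose_matrix_vector)
qed

lemma mat_M_quadratic_form:
  "homogenize \<xi> \<bullet> (mat_M P l x *v homogenize \<xi>) = rhs_T P l x \<bullet> \<xi> + rhs_h P l x"
  by (simp add: mat_M_def bordered_quadratic_form)

lemma mat_P_quadratic_form:
  "homogenize \<xi> \<bullet> (mat_P P V j \<rho> *v homogenize \<xi>) =
    (\<Sum>q\<in>region_rows j. \<rho> q * (region_S P V j q \<bullet> \<xi> - region_t P V j q))"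
  by (simp add: mat_P_def bordered_quadratic_form inner_sum_left right_diff_distrib
      sum_subtractf mult.commute)

text \<open>Expanding the squared norm and moving the symmetric \<open>ell_A V j\<close> across the
  inner product gives the blocks of \<open>mat_J\<close>. Nonpositivity of the form is thus
  membership in the ellipsoid.\<close>

lemma mat_J_quadratic_form:
  assumes "symmetric_matrix (ell_A V j)"
  shows "homogenize \<xi> \<bullet> (mat_J V j *v homogenize \<xi>) =
    (norm (ell_A V j *v \<xi> + ell_b V j))\<^sup>2 - 1"
proof -
  have tr: "(ell_A V j *v u) \<bullet> w = u \<bullet> (ell_A V j *v w)" for u w
    using assms
    by (metis dot_lmul_matrix symmetric_matrix_def transpose_matrix_vector)
  have "(norm (ell_A V j *v \<xi> + ell_b V j))\<^sup>2 =
      \<xi> \<bullet> (ell_A V j *v (ell_A V j *v \<xi>)) + 2 * ((ell_A V j *v ell_b V j) \<bullet> \<xi>) +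
      ell_b V j \<bullet> ell_b V j"
    unfolding power2_norm_eq_inner inner_add_left inner_add_right
    using tr[of \<xi> "ell_A V j *v \<xi>"] tr[of "ell_b V j" \<xi>]
    by (simp add: inner_commute[of "ell_A V j *v \<xi>" "ell_b V j"])
  moreover have "transpose (ell_A V j) = ell_A V j"
    using assms by (simp add: symmetric_matrix_def)
  ultimately show ?thesis
    unfolding mat_J_def bordered_quadratic_form matrix_vector_mul_assoc by simp
qed

lemma mat_P_nonpos:
  assumes "\<xi> \<in> region P V j" "\<And>q. q \<in> region_rows j \<Longrightarrow> 0 \<le> \<rho> q"
  shows "homogenize \<xi> \<bullet> (mat_P P V j \<rho> *v homogenize \<xi>) \<le> 0"
  unfolding mat_P_quadratic_form
  using assms by (intro sum_nonpos mult_nonneg_nonpos) (auto simp: region_polyhedron)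

lemma mat_J_nonpos:
  assumes "pos_def (ell_A V j)"
    and "region P V j \<subseteq> {\<xi>. (norm (ell_A V j *v \<xi> + ell_b V j))\<^sup>2 \<le> 1}"
    and "\<xi> \<in> region P V j"
  shows "homogenize \<xi> \<bullet> (mat_J V j *v homogenize \<xi>) \<le> 0"
  using assms by (subst mat_J_quadratic_form) (auto simp: pos_def_def)

text \<open>The easy half of the S-lemma.\<close>

lemma psd_nonneg_on_region:
  assumes "pos_def (ell_A V j)"
    and "region P V j \<subseteq> {\<xi>. (norm (ell_A V j *v \<xi> + ell_b V j))\<^sup>2 \<le> 1}"
    and "\<xi> \<in> region P V j"
    and "\<And>q. q \<in> region_rows j \<Longrightarrow> 0 \<le> \<rho> q" "0 \<le> c"
    and "psd (A - B + mat_P P V j \<rho> + c *\<^sub>R mat_J V j)"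
  shows "homogenize \<xi> \<bullet> (B *v homogenize \<xi>) \<le> homogenize \<xi> \<bullet> (A *v homogenize \<xi>)"
proof -
  have "0 \<le> homogenize \<xi> \<bullet> ((A - B + mat_P P V j \<rho> + c *\<^sub>R mat_J V j) *v homogenize \<xi>)"
    using assms(6) unfolding psd_def by blast
  moreover have "c * (homogenize \<xi> \<bullet> (mat_J V j *v homogenize \<xi>)) \<le> 0"
    using mat_J_nonpos[OF assms(1-3)] \<open>0 \<le> c\<close> by (rule mult_nonneg_nonpos[rotated])
  ultimately show ?thesis
    using mat_P_nonpos[OF assms(3), of \<rho>] assms(4)
    unfolding quadratic_form_add quadratic_form_diff quadratic_form_scaleR by fastforce
qed


section \<open>The partition and the piecewise affine rule\<close>

lemma closed_halfspaces: "closed {x. \<forall>q\<in>I. a q \<bullet> x \<le> b q}" for a :: "'i \<Rightarrow> 'a::real_inner"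
proof -
  have "{x. \<forall>q\<in>I. a q \<bullet> x \<le> b q} = (\<Inter>q\<in>I. {x. a q \<bullet> x \<le> b q})"
    by blast
  then show ?thesis
    by (simp add: closed_INT closed_halfspace_le)
qed

lemma closed_support: "closed (support P)"
  using closed_halfspaces[of UNIV "($) (supp_S P)" "($) (supp_t P)"]
  by (simp add: support_def less_eq_vec_def matrix_vector_mul_component)

lemma closed_region: "closed (region P V j)"
  unfolding region_polyhedron by (rule closed_halfspaces)

text \<open>Among finitely many constructor points one is nearest to \<open>\<xi>\<close>, and its
  region contains \<open>\<xi>\<close>.\<close>

lemma support_subset_regions:
  fixes P :: "('n1::finite, 'n2::finite, 'k::finite, 'm::finite, 'l::finite) two_stage"
    and V :: "('k, 'j::finite) partition"
  assumes "\<xi> \<in> support P"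
  shows "\<exists>j. \<xi> \<in> region P V j"
proof -
  define f where "f = (\<lambda>i. norm (\<xi> - pts V i))"
  have "Min (range f) \<in> range f"
    by (intro Min_in) auto
  then obtain j where "f j = Min (range f)"
    by (metis imageE)
  then have "f j \<le> f i" for i
    by simp
  then show ?thesis
    using assms by (auto simp: region_def support_def f_def)
qed

text \<open>The sets may overlap, as neighbouring regions do. Ties are broken by priority: each
  inserted set overrides the earlier choices, which keeps the function measurable.\<close>

lemma measurable_selection_finite:
  fixes F :: "'j \<Rightarrow> 'a::topological_space \<Rightarrow> 'b::topological_space"
  assumes "finite J" "\<And>j. A j \<in> sets borel" "\<And>j. F j \<in> borel_measurable borel"
  shows "\<exists>f\<in>borel_measurable borel. \<forall>x\<in>(\<Union>j\<in>J. A j). \<exists>j\<in>J. x \<in> A j \<and> f x = F j x"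
  using assms(1)
proof (induction J)
  case empty
  show ?case by (intro bexI[of _ "\<lambda>_. undefined"]) auto
next
  case (insert j J)
  then obtain f where f: "f \<in> borel_measurable borel"
    "\<And>x. x \<in> (\<Union>j\<in>J. A j) \<Longrightarrow> \<exists>j\<in>J. x \<in> A j \<and> f x = F j x"
    by blast
  have "(\<lambda>x. if x \<in> A j then F j x else f x) \<in> borel_measurable borel"
    using assms(2,3) f(1) by (intro measurable_If_set) auto
  moreover have "\<forall>x\<in>(\<Union>j\<in>insert j J. A j).
      \<exists>i\<in>insert j J. x \<in> A i \<and> (if x \<in> A j then F j x else f x) = F i x"
    using f(2) by (smt (verit) UN_iff insert_iff)
  ultimately show ?case
    by (rule bexI[of _ "\<lambda>x. if x \<in> A j then F j x else f x", rotated])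
qed

text \<open>\<open>R_value\<close> ranges over measurable rules only, so the overlaps of the closed
  regions must be resolved measurably.\<close>

lemma piecewise_rule_exists:
  fixes P :: "('n1::finite, 'n2::finite, 'k::finite, 'm::finite, 'l::finite) two_stage"
    and V :: "('k, 'j::finite) partition"
  shows "\<exists>y\<in>borel_measurable borel. piecewise_rule P V Y y\<^sub>0 y"
proof -
  have "(\<lambda>\<xi>. Y j *v \<xi> + y\<^sub>0 j) \<in> borel_measurable borel" for j
    by (intro borel_measurable_continuous_onI continuous_on_add continuous_on_const
        linear_continuous_on matrix_vector_mul_bounded_linear)
  then have "\<exists>y\<in>borel_measurable borel. \<forall>\<xi>\<in>(\<Union>j. region P V j).
      \<exists>j\<in>UNIV. \<xi> \<in> region P V j \<and> y \<xi> = Y j *v \<xi> + y\<^sub>0 j"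
    by (intro measurable_selection_finite borel_closed closed_region) auto
  then obtain y where "y \<in> borel_measurable borel"
    "\<forall>\<xi>\<in>(\<Union>j. region P V j). \<exists>j\<in>UNIV. \<xi> \<in> region P V j \<and> y \<xi> = Y j *v \<xi> + y\<^sub>0 j"
    by (elim bexE)
  then show ?thesis
    using support_subset_regions[of _ P V] unfolding piecewise_rule_def
    by (metis UNIV_I UN_I)
qed

lemma piecewise_rule_feasible:
  fixes s :: "('n1::finite, 'n2::finite, 'k::finite, 'm::finite, 'l::finite, 'j::finite) sdp_vars"
  assumes "\<And>j. pos_def (ell_A V j)"
    and "\<And>j. region P V j \<subseteq> {\<xi>. (norm (ell_A V j *v \<xi> + ell_b V j))\<^sup>2 \<le> 1}"
    and "sdp_feasible P V s" "piecewise_rule P V (var_Y s) (var_y s) y"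
  shows "R_feasible P (var_x s) y"
  unfolding R_feasible_def
proof (intro conjI ballI allI)
  show "var_x s \<in> first_stage P"
    using assms(3) by (simp add: sdp_feasible_def)
  fix \<xi> l assume "\<xi> \<in> support P"
  then obtain j where j: "\<xi> \<in> region P V j" "y \<xi> = var_Y s j *v \<xi> + var_y s j"
    using assms(4) by (auto simp: piecewise_rule_def)
  show "rhs_T P l (var_x s) \<bullet> \<xi> + rhs_h P l (var_x s) \<le> (rec_W P l *v \<xi> + rec_w P l) \<bullet> y \<xi>"
    unfolding j(2) mat_bil_quadratic_form[symmetric] mat_M_quadratic_form[symmetric]
    using assms(3)
    by (intro psd_nonneg_on_region[OF assms(1,2) j(1), of "var_rho s j l" "var_lambda s j l"])
       (auto simp: sdp_feasible_def)
qed

text \<open>\<open>\<Gamma>\<close>, \<open>\<beta>\<close> and \<open>\<alpha>\<close> do not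
  depend on \<open>j\<close>, so the bounds on the single regions combine into one quadratic
  majorant on the whole support.\<close>

lemma piecewise_rule_cost_le:
  fixes s :: "('n1::finite, 'n2::finite, 'k::finite, 'm::finite, 'l::finite, 'j::finite) sdp_vars"
  assumes "\<And>j. pos_def (ell_A V j)"
    and "\<And>j. region P V j \<subseteq> {\<xi>. (norm (ell_A V j *v \<xi> + ell_b V j))\<^sup>2 \<le> 1}"
    and "sdp_feasible P V s" "piecewise_rule P V (var_Y s) (var_y s) y" "\<xi> \<in> support P"
  shows "(cost_D P *v \<xi> + cost_d P) \<bullet> y \<xi> \<le>
    \<xi> \<bullet> (var_Gamma s *v \<xi>) + var_beta s \<bullet> \<xi> + var_alpha s"
proof -
  obtain j where j: "\<xi> \<in> region P V j" "y \<xi> = var_Y s j *v \<xi> + var_y s j"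
    using assms(4,5) by (auto simp: piecewise_rule_def)
  have "\<xi> \<bullet> (var_Gamma s *v \<xi>) + var_beta s \<bullet> \<xi> + var_alpha s = homogenize \<xi> \<bullet>
      (bordered (var_Gamma s) ((1/2) *\<^sub>R var_beta s) (var_alpha s) *v homogenize \<xi>)"
    by (simp add: bordered_quadratic_form)
  then show ?thesis
    unfolding j(2) mat_bil_quadratic_form[symmetric]
    using assms(3)
    by (simp only:) (intro psd_nonneg_on_region[OF assms(1,2) j(1), of "var_gamma s j" "var_delta s j"],
        auto simp: sdp_feasible_def)
qed


section \<open>Worst-case expectations\<close>

text \<open>The positive part grows and the negative part shrinks. Neither measurability nor
  integrability is required, so an arbitrary rule can be compared with its quadratic
  majorant.\<close>

lemma expect_mono_AE:
  assumes "AE z in Q. f z \<le> g z"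
  shows "expect Q f \<le> expect Q g"
  unfolding expect_def
  using assms
  by (intro ereal_minus_mono)
     (auto simp: less_eq_ennreal.rep_eq[symmetric] intro!: nn_integral_mono_AE ennreal_leI)

lemma expect_eq_integral:
  assumes "integrable Q f"
  shows "expect Q f = ereal (\<integral>z. f z \<partial>Q)"
proof -
  obtain r q where "0 \<le> r" "0 \<le> q" "(\<integral>\<^sup>+ z. ennreal (f z) \<partial>Q) = ennreal r"
    "(\<integral>\<^sup>+ z. ennreal (- f z) \<partial>Q) = ennreal q" "(\<integral>z. f z \<partial>Q) = r - q"
    using integrableE[OF assms] by metis
  then show ?thesis
    by (simp add: expect_def enn2ereal_ennreal)
qed

lemma ambiguity_AE_support:
  assumes "Q \<in> ambiguity P"
  shows "AE \<xi> in Q. \<xi> \<in> support P"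
proof -
  interpret prob_space Q using assms by (simp add: ambiguity_def)
  show ?thesis
    using assms by (intro AE_prob_1) (auto simp: ambiguity_def)
qed

text \<open>The support is closed and bounded, hence compact, so a continuous function is almost
  surely bounded under a probability measure.\<close>

lemma ambiguity_integrable:
  fixes f :: "real^'k \<Rightarrow> 'b::euclidean_space"
  assumes "Q \<in> ambiguity P" "bounded (support P)" "continuous_on UNIV f"
  shows "integrable Q f"
proof -
  interpret prob_space Q using assms(1) by (simp add: ambiguity_def)
  have "compact (f ` support P)"
    using assms(2,3) closed_support
    by (intro compact_continuous_image) (auto simp: compact_eq_bounded_closed
        intro: continuous_on_subset)
  then obtain B where "\<And>\<xi>. \<xi> \<in> support P \<Longrightarrow> norm (f \<xi>) \<le> B"
    by (metis bounded_iff compact_imp_bounded image_eqI)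
  then have "AE \<xi> in Q. norm (f \<xi>) \<le> B"
    using ambiguity_AE_support[OF assms(1)] by auto
  moreover have "f \<in> borel_measurable Q"
    using borel_measurable_continuous_onI[OF assms(3)] assms(1)
    by (simp add: ambiguity_def cong: measurable_cong_sets)
  ultimately show ?thesis by (rule integrable_const_bound)
qed

lemma ambiguity_quadratic_expectation:
  assumes Q: "Q \<in> ambiguity P" and bdd: "bounded (support P)" and psd: "psd G"
  shows "expect Q (\<lambda>\<xi>. \<xi> \<bullet> (G *v \<xi>) + \<beta> \<bullet> \<xi> + \<alpha>) \<le>
    ereal (trace (G ** mom_Sigma P) + \<beta> \<bullet> mean_mu P + \<alpha>)"
proof -
  interpret prob_space Q using Q by (simp add: ambiguity_def)
  note int = ambiguity_integrable[OF Q bdd]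
  have int_id: "integrable Q (\<lambda>\<xi>. \<xi>)"
    by (intro int continuous_intros)
  have int_outer: "integrable Q outer"
    unfolding outer_def by (intro int continuous_intros)
  \<comment> \<open>The quadratic term is a linear function of \<open>outer \<xi>\<close>, so the
    integral can be taken inside the trace.\<close>
  have bl: "bounded_linear (\<lambda>A. trace (G ** A))"
    using linear_trace_mult by (simp add: linear_conv_bounded_linear)
  have int_tr: "integrable Q (\<lambda>\<xi>. trace (G ** outer \<xi>))"
    by (rule integrable_bounded_linear[OF bl int_outer])
  have "(\<integral>\<xi>. \<xi> \<bullet> (G *v \<xi>) + \<beta> \<bullet> \<xi> + \<alpha> \<partial>Q) = (\<integral>\<xi>. trace (G ** outer \<xi>) + \<beta> \<bullet> \<xi> + \<alpha> \<partial>Q)"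
    by (simp add: trace_mult_outer)
  also have "\<dots> = (\<integral>\<xi>. trace (G ** outer \<xi>) \<partial>Q) + (\<integral>\<xi>. \<beta> \<bullet> \<xi> \<partial>Q) + \<alpha>"
    using int_tr int_id by (simp add: prob_space)
  also have "(\<integral>\<xi>. trace (G ** outer \<xi>) \<partial>Q) = trace (G ** (\<integral>\<xi>. outer \<xi> \<partial>Q))"
    by (rule integral_bounded_linear[OF bl int_outer])
  also have "(\<integral>\<xi>. \<beta> \<bullet> \<xi> \<partial>Q) = \<beta> \<bullet> mean_mu P"
    using Q int_id by (simp add: ambiguity_def)
  \<comment> \<open>The only inequality in the chain: the mean is prescribed exactly, the second
    moment is only bounded above.\<close>
  also have "trace (G ** (\<integral>\<xi>. outer \<xi> \<partial>Q)) \<le> trace (G ** mom_Sigma P)"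
  proof -
    have "psd (mom_Sigma P - (\<integral>\<xi>. outer \<xi> \<partial>Q))"
      using Q by (simp add: ambiguity_def outer_def)
    then have "0 \<le> trace (G ** (mom_Sigma P - (\<integral>\<xi>. outer \<xi> \<partial>Q)))"
      by (rule trace_psd_mult_nonneg[OF psd])
    then show ?thesis
      by (simp add: linear_diff[OF linear_trace_mult])
  qed
  finally have le: "(\<integral>\<xi>. \<xi> \<bullet> (G *v \<xi>) + \<beta> \<bullet> \<xi> + \<alpha> \<partial>Q) \<le>
      trace (G ** mom_Sigma P) + \<beta> \<bullet> mean_mu P + \<alpha>"
    by simp
  have "integrable Q (\<lambda>\<xi>. \<xi> \<bullet> (G *v \<xi>) + \<beta> \<bullet> \<xi> + \<alpha>)"
    using int_tr int_id by (simp add: trace_mult_outer)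
  then show ?thesis
    using le by (simp add: expect_eq_integral)
qed

lemma R_objective_le_sdp_objective:
  fixes s :: "('n1::finite, 'n2::finite, 'k::finite, 'm::finite, 'l::finite, 'j::finite) sdp_vars"
  assumes "bounded (support P)" "\<And>j. pos_def (ell_A V j)"
    and "\<And>j. region P V j \<subseteq> {\<xi>. (norm (ell_A V j *v \<xi> + ell_b V j))\<^sup>2 \<le> 1}"
    and "sdp_feasible P V s" "piecewise_rule P V (var_Y s) (var_y s) y"
  shows "R_objective P (var_x s) y \<le> ereal (sdp_objective P s)"
proof -
  have "expect Q (\<lambda>\<xi>. (cost_D P *v \<xi> + cost_d P) \<bullet> y \<xi>) \<le>
      ereal (trace (var_Gamma s ** mom_Sigma P) + var_beta s \<bullet> mean_mu P + var_alpha s)"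
    if "Q \<in> ambiguity P" for Q
  proof (rule order_trans[OF expect_mono_AE ambiguity_quadratic_expectation[OF that assms(1)]])
    show "psd (var_Gamma s)"
      using assms(4) by (simp add: sdp_feasible_def)
    show "AE \<xi> in Q. (cost_D P *v \<xi> + cost_d P) \<bullet> y \<xi> \<le>
        \<xi> \<bullet> (var_Gamma s *v \<xi>) + var_beta s \<bullet> \<xi> + var_alpha s"
      using ambiguity_AE_support[OF that] piecewise_rule_cost_le[OF assms(2-5)] by fastforce
  qed
  \<comment> \<open>This also covers an empty ambiguity set, whose supremum is -infinity.\<close>
  then have "R_objective P (var_x s) y \<le> ereal (cost_c P \<bullet> var_x s) +
      ereal (trace (var_Gamma s ** mom_Sigma P) + var_beta s \<bullet> mean_mu P + var_alpha s)"
    unfolding R_objective_def by (intro add_left_mono SUP_least)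
  then show ?thesis
    by (simp add: sdp_objective_def algebra_simps)
qed

theorem proposition3:
  fixes P :: "('n1::finite, 'n2::finite, 'k::finite, 'm::finite, 'l::finite) two_stage"
    and V :: "('k, 'j::finite) partition"
  assumes "convex (first_stage P)"
    and "\<And>l. affine_map_on (first_stage P) (rhs_T P l)"
    and "\<And>l. affine_map_on (first_stage P) (rhs_h P l)"
    and "bounded (support P)"
    and "symmetric_matrix (mom_Sigma P)"
    and "\<And>j. pts V j \<in> support P"
    and "\<And>j. pos_def (ell_A V j)"
    and "\<And>j. region P V j \<subseteq> {\<xi>. (norm (ell_A V j *v \<xi> + ell_b V j))\<^sup>2 \<le> 1}"
  shows "(\<forall>s :: ('n1, 'n2, 'k, 'm, 'l, 'j) sdp_vars. sdp_feasible P V s \<longrightarrow>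
           (\<exists>y\<in>borel_measurable borel. piecewise_rule P V (var_Y s) (var_y s) y) \<and>
           (\<forall>y. piecewise_rule P V (var_Y s) (var_y s) y \<longrightarrow> R_feasible P (var_x s) y))
         \<and> R_value P \<le> sdp_value P V"
proof (intro conjI allI impI)
  fix s :: "('n1, 'n2, 'k, 'm, 'l, 'j) sdp_vars"
  show "\<exists>y\<in>borel_measurable borel. piecewise_rule P V (var_Y s) (var_y s) y"
    by (rule piecewise_rule_exists)
  show "R_feasible P (var_x s) y"
    if "sdp_feasible P V s" "piecewise_rule P V (var_Y s) (var_y s) y" for y
    using piecewise_rule_feasible[OF assms(7,8) that] .
next
  have "R_value P \<le> ereal (sdp_objective P s)"
    if s: "sdp_feasible P V s" for s :: "('n1, 'n2, 'k, 'm, 'l, 'j) sdp_vars"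
  proof -
    obtain y where y: "y \<in> borel_measurable borel" "piecewise_rule P V (var_Y s) (var_y s) y"
      using piecewise_rule_exists by blast
    then have "R_value P \<le> R_objective P (var_x s) y"
      unfolding R_value_def using piecewise_rule_feasible[OF assms(7,8) s y(2)]
      by (intro Inf_lower) blast
    also have "\<dots> \<le> ereal (sdp_objective P s)"
      by (rule R_objective_le_sdp_objective[OF assms(4,7,8) s y(2)])
    finally show ?thesis .
  qed
  \<comment> \<open>If the semidefinite program is infeasible, \<open>sdp_value\<close> is the
    infimum of the empty set, which is infinity, and the bound still holds.\<close>
  then show "R_value P \<le> sdp_value P V"
    unfolding sdp_value_def by (intro Inf_greatest) blast
qed

end
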